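(* Let $F$ be a non-empty forest, and write $\tilde\Delta(F)=\sum_{(F)}F^{(1)}\otimes F^{(2)}$. Then $$\pi_1(F)=F-\sum_{(F)}F^{(1)}\top\pi_1(F^{(2)}),$$ where the sum is understood via the linear map $x\otimes y\mapsto x\top\pi_1(y)$.
   Context: ${\cal H}_R$ is the commutative polynomial algebra over $\mathbb{Q}$ on isomorphism classes of rooted trees (finite connected simply connected graphs with a root, edges oriented away from the root; weight = number of vertices); monomials are forests, $1$ is the empty forest. Coproduct: the algebra morphism with $\Delta(t)=1\otimes t+t\otimes1+\sum_CP^C(t)\otimes R^C(t)$ over admissible cuts $C$ of $t$ (nonempty edge sets meeting each root-to-vertex path at most once; $R^C(t)$ = component containing the root, $P^C(t)$ = product of the others). $\tilde\Delta(x)=\Delta(x)-1\otimes x-x\otimes1$; $Prim({\cal H}_R)=\ker\tilde\Delta$. For forests $M,N$: $M\top N=0$ if $N=1$, else $\frac{1}{weight(N)}\sum_vN_v$, $v$ over vertices of $N$, $N_v$ obtained from $N$ by attaching every tree of $M$ to $v$; bilinear extension. $F_i:Prim({\cal H}_R)^{\otimes i}\to{\cal H}_R$, $p_i\otimes\cdots\otimes p_1\mapsto(\cdots(p_i\top p_{i-1})\cdots)\top p_1$; $F_1$ is the inclusion, so $Im(F_1)=Prim({\cal H}_R)$. One has ${\cal H}_R=\mathbb{Q}1\oplus\bigoplus_{j\ge1}Im(F_j)$, and $\pi_1$ is the projection onto $Im(F_1)$ vanishing on $\mathbb{Q}1\oplus\bigoplus_{j\ge2}Im(F_j)$. *)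

theory Defs
  imports Complex_Main "HOL-Library.Multiset"
begin

text \<open>A rooted tree up to isomorphism is a root together with the multiset of
  its (unordered) subtrees; a forest is a multiset of trees; the empty forest is 1.\<close>

datatype rtree = Node "rtree multiset"

type_synonym forest = "rtree multiset"

primrec nv :: "rtree \<Rightarrow> nat" where
  "nv (Node cs) = Suc (sum_mset (image_mset nv cs))"

definition weight :: "forest \<Rightarrow> nat" where
  "weight F = sum_mset (image_mset nv F)"

text \<open>Terms P^C \<otimes> R^C are recorded as pairs of forests. The product of two
  families of terms (multiplicativity over disjoint unions).\<close>

definition cprod :: "(forest \<times> forest) multiset \<Rightarrow> (forest \<times> forest) multiset \<Rightarrow> (forest \<times> forest) multiset" where
  "cprod M N = sum_mset (image_mset (\<lambda>a. image_mset (\<lambda>b. (fst a + fst b, snd a + snd b)) N) M)"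

definition mprod :: "(forest \<times> forest) multiset multiset \<Rightarrow> (forest \<times> forest) multiset" where
  "mprod Ms = fold_mset cprod {#({#}, {#})#} Ms"

text \<open>coT t = multiset of all terms P \<otimes> R of Delta(t): the total term t \<otimes> 1 and, for
  every admissible cut C (including the empty cut, giving 1 \<otimes> t), the term
  P^C(t) \<otimes> R^C(t).  Cuts of Node cs are enumerated child by child: for every child c
  either the edge to c is cut (c goes to P) or an admissible (possibly empty) cut
  is performed inside c; this enumerates exactly the edge sets meeting every
  root-to-vertex path at most once, each once.\<close>

primrec coT :: "rtree \<Rightarrow> (forest \<times> forest) multiset" where
  "coT (Node cs) = add_mset ({#Node cs#}, {#})
      (image_mset (\<lambda>(P, Rs). (P, {#Node Rs#})) (mprod (image_mset coT cs)))"

definition coF :: "forest \<Rightarrow> (forest \<times> forest) multiset" where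
  "coF F = mprod (image_mset coT F)"

type_synonym H = "forest \<Rightarrow> rat"
type_synonym HH = "forest \<times> forest \<Rightarrow> rat"

definition supp :: "('a \<Rightarrow> rat) \<Rightarrow> 'a set" where
  "supp x = {a. x a \<noteq> 0}"

definition finsupp :: "('a \<Rightarrow> rat) \<Rightarrow> bool" where
  "finsupp x \<longleftrightarrow> finite (supp x)"

definition basis :: "'a \<Rightarrow> 'a \<Rightarrow> rat" where
  "basis a = (\<lambda>b. if b = a then 1 else 0)"

definition hadd :: "('a \<Rightarrow> rat) \<Rightarrow> ('a \<Rightarrow> rat) \<Rightarrow> 'a \<Rightarrow> rat" where
  "hadd x y = (\<lambda>a. x a + y a)"

definition hsub :: "('a \<Rightarrow> rat) \<Rightarrow> ('a \<Rightarrow> rat) \<Rightarrow> 'a \<Rightarrow> rat" where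
  "hsub x y = (\<lambda>a. x a - y a)"

definition hscale :: "rat \<Rightarrow> ('a \<Rightarrow> rat) \<Rightarrow> 'a \<Rightarrow> rat" where
  "hscale c x = (\<lambda>a. c * x a)"

definition qspan :: "('a \<Rightarrow> rat) set \<Rightarrow> ('a \<Rightarrow> rat) set" where
  "qspan S = {x. \<exists>T c. finite T \<and> T \<subseteq> S \<and> x = (\<lambda>a. \<Sum>v\<in>T. c v * v a)}"

definition one :: H where
  "one = basis {#}"

definition DeltaF :: "forest \<Rightarrow> HH" where
  "DeltaF F = (\<lambda>p. of_nat (count (coF F) p))"

definition Delta :: "H \<Rightarrow> HH" where
  "Delta x = (\<lambda>p. \<Sum>G\<in>supp x. x G * DeltaF G p)"

definition tens :: "H \<Rightarrow> H \<Rightarrow> HH" where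
  "tens x y = (\<lambda>(A, B). x A * y B)"

definition DeltaRed :: "H \<Rightarrow> HH" where
  "DeltaRed x = hsub (hsub (Delta x) (tens one x)) (tens x one)"

definition Prim :: "H set" where
  "Prim = {x. finsupp x \<and> DeltaRed x = (\<lambda>_. 0)}"

text \<open>graftT M t: multiset (indexed by the vertices v of t) of the trees t_v
  obtained by attaching every tree of M to v.\<close>

primrec graftT :: "forest \<Rightarrow> rtree \<Rightarrow> rtree multiset" where
  "graftT M (Node cs) = add_mset (Node (cs + M))
     (sum_mset (image_mset (\<lambda>(c, gs). image_mset (\<lambda>g. Node (add_mset g (cs - {#c#}))) gs)
        (image_mset (\<lambda>c. (c, graftT M c)) cs)))"

definition graftF :: "forest \<Rightarrow> forest \<Rightarrow> forest multiset" where
  "graftF M N = sum_mset (image_mset (\<lambda>t. image_mset (\<lambda>g. add_mset g (N - {#t#})) (graftT M t)) N)"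

definition topF :: "forest \<Rightarrow> forest \<Rightarrow> H" where
  "topF M N = (if N = {#} then (\<lambda>_. 0)
               else (\<lambda>C. of_nat (count (graftF M N) C) / of_nat (weight N)))"

definition top :: "H \<Rightarrow> H \<Rightarrow> H" where
  "top x y = (\<lambda>C. \<Sum>A\<in>supp x. \<Sum>B\<in>supp y. x A * y B * topF A B C)"

text \<open>F_i(p_i \<otimes> ... \<otimes> p_1) = (...(p_i \<top> p_{i-1})...) \<top> p_1; the list is [p_i, ..., p_1].\<close>

definition Fmap :: "H list \<Rightarrow> H" where
  "Fmap ps = foldl top (hd ps) (tl ps)"

text \<open>Im(F_j): image of Prim^{\<otimes>j} under the linear map F_j, i.e. the span of
  the values on pure tensors.\<close>

definition ImF :: "nat \<Rightarrow> H set" where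
  "ImF j = qspan {Fmap ps | ps. length ps = j \<and> set ps \<subseteq> Prim}"

text \<open>pi_1: projection onto Im(F_1) = Prim along Q1 \<oplus> \<Oplus>_{j\<ge>2} Im(F_j).\<close>

definition pi1 :: "H \<Rightarrow> H" where
  "pi1 x = (THE p. p \<in> Prim \<and> hsub x p \<in> qspan ({one} \<union> (\<Union>j\<in>{2..}. ImF j)))"

definition topPi :: "HH \<Rightarrow> H" where
  "topPi T = (\<lambda>C. \<Sum>p\<in>supp T. T p * top (basis (fst p)) (pi1 (basis (snd p))) C)"

end

theory Submission
  imports Defs
begin

text \<open>For primitive \<open>p\<close> one has \<open>\<Delta>(x \<top> p) = (x \<top> p) \<otimes> 1 + (id \<otimes> (\<cdot> \<top> p)) (\<Delta> x)\<close>.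
  Let \<open>\<pi>\<close> be defined by the recursion of the theorem, with \<open>\<pi>(1) = 0\<close>; equivalently
  \<open>\<top> \<circ> (id \<otimes> \<pi>) \<circ> \<Delta> = id - \<epsilon>\<close>, where \<open>\<epsilon>\<close> is the counit. With coassociativity, the formula for
  \<open>\<Delta>(x \<top> p)\<close> shows by induction on the weight that \<open>\<pi>(F)\<close> is primitive, hence that \<open>F - \<pi>(F)\<close> is a
  combination of values of the \<open>F\<^sub>j\<close>, \<open>j \<ge> 2\<close>. The same formula gives \<open>\<pi>(p) = p\<close> and
  \<open>\<pi>(x \<top> p) = 0\<close> for \<open>\<epsilon>(x) = 0\<close>, so \<open>\<pi>\<close> vanishes on \<open>1\<close> and on every \<open>Im(F\<^sub>j)\<close>, \<open>j \<ge> 2\<close>. This makes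
  the primitive part in the definition of \<open>\<pi>\<^sub>1\<close> unique and equal to \<open>\<pi>\<close>.\<close>

text \<open>Elements of \<open>H\<close> and of its tensor powers are handled through their values under arbitrary linear
  forms, given by a function on the basis: \<open>cosum F \<phi>\<close> is \<open>\<phi>\<close> applied to \<open>\<Delta>(F)\<close>, and \<open>grsum M N \<phi>\<close> is
  \<open>\<phi>\<close> applied to \<open>weight N \<cdot> (M \<top> N)\<close>.\<close>

definition cosum :: "forest \<Rightarrow> (forest \<Rightarrow> forest \<Rightarrow> rat) \<Rightarrow> rat" where
  "cosum F \<phi> = (\<Sum>p\<in>#coF F. \<phi> (fst p) (snd p))"

definition grsum :: "forest \<Rightarrow> forest \<Rightarrow> (forest \<Rightarrow> rat) \<Rightarrow> rat" where
  "grsum M N \<phi> = (\<Sum>C\<in>#graftF M N. \<phi> C)"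

section \<open>The coproduct on forests: multiplicativity, cocycle identity, coassociativity\<close>

lemma sum_mset_cprod:
  fixes \<phi> :: "forest \<times> forest \<Rightarrow> 'b::comm_monoid_add"
  shows "(\<Sum>p\<in>#cprod M N. \<phi> p) = (\<Sum>a\<in>#M. \<Sum>b\<in>#N. \<phi> (fst a + fst b, snd a + snd b))"
  unfolding cprod_def by (induction M) (simp_all add: image_mset.compositionality comp_def)

lemma multiset_eqI_sum_mset:
  fixes M N :: "'a multiset"
  assumes "\<And>\<phi> :: 'a \<Rightarrow> 'a multiset. (\<Sum>a\<in>#M. \<phi> a) = (\<Sum>a\<in>#N. \<phi> a)"
  shows "M = N"
  using assms[of "\<lambda>a. {#a#}"] by simp

text \<open>This makes the fold in \<open>mprod\<close> independent of the order of the
  factors.\<close>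

lemma cprod_left_commute: "cprod L (cprod M N) = cprod M (cprod L N)"
proof (rule multiset_eqI_sum_mset)
  fix \<phi> :: "forest \<times> forest \<Rightarrow> (forest \<times> forest) multiset"
  show "(\<Sum>p\<in>#cprod L (cprod M N). \<phi> p) = (\<Sum>p\<in>#cprod M (cprod L N). \<phi> p)"
    by (simp add: sum_mset_cprod sum_mset.swap[of _ L M] add.left_commute)
qed

interpretation cprod: comp_fun_commute cprod
  by unfold_locales (simp add: fun_eq_iff cprod_left_commute)

lemma mprod_empty [simp]: "mprod {#} = {#({#}, {#})#}"
  by (simp add: mprod_def)

lemma mprod_add_mset [simp]: "mprod (add_mset M Ms) = cprod M (mprod Ms)"
  by (simp add: mprod_def)

lemma cosum_empty [simp]: "cosum {#} \<phi> = \<phi> {#} {#}"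
  by (simp add: cosum_def coF_def)

lemma cosum_zero [simp]: "cosum F (\<lambda>A B. 0) = 0"
  by (simp add: cosum_def)

lemma cosum_plus: "cosum F (\<lambda>A B. \<phi> A B + \<psi> A B) = cosum F \<phi> + cosum F \<psi>"
  by (simp add: cosum_def sum_mset.distrib)

lemma cosum_swap:
  "cosum F (\<lambda>A B. cosum G (\<lambda>C D. \<phi> A B C D)) = cosum G (\<lambda>C D. cosum F (\<lambda>A B. \<phi> A B C D))"
  unfolding cosum_def by (rule sum_mset.swap)

lemma cosum_singleton_coT: "cosum {#t#} \<phi> = (\<Sum>p\<in>#coT t. \<phi> (fst p) (snd p))"
  by (simp add: cosum_def coF_def sum_mset_cprod)

text \<open>The Hochschild cocycle identity of the operator that joins the trees of a forest under a
  new root.\<close>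

lemma cosum_Node:
  "cosum {#Node cs#} \<phi> = \<phi> {#Node cs#} {#} + cosum cs (\<lambda>P R. \<phi> P {#Node R#})"
  unfolding cosum_singleton_coT
  by (simp add: cosum_def coF_def image_mset.compositionality comp_def case_prod_beta)

lemma cosum_add_mset:
  "cosum (add_mset t F) \<phi> = cosum {#t#} (\<lambda>A B. cosum F (\<lambda>C D. \<phi> (A + C) (B + D)))"
  unfolding cosum_singleton_coT
  by (simp add: cosum_def coF_def sum_mset_cprod)

lemma cosum_union:
  "cosum (F + G) \<phi> = cosum F (\<lambda>A B. cosum G (\<lambda>C D. \<phi> (A + C) (B + D)))"
proof (induction F arbitrary: \<phi>)
  case (add t F)
  have "cosum (add_mset t F + G) \<phi> = cosum (add_mset t (F + G)) \<phi>"
    by simp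
  also have "\<dots> = cosum {#t#} (\<lambda>A B. cosum F (\<lambda>A' B'. cosum G (\<lambda>C D. \<phi> (A + A' + C) (B + B' + D))))"
    by (subst cosum_add_mset) (simp only: add add.assoc)
  also have "\<dots> = cosum (add_mset t F) (\<lambda>A B. cosum G (\<lambda>C D. \<phi> (A + C) (B + D)))"
    by (rule cosum_add_mset[symmetric])
  finally show ?case .
qed simp

text \<open>Forests arise from 1 by products and by adding roots, so one induction on forests
  replaces a mutual one on trees and forests and fits the recursions of \<open>cosum\<close> and
  \<open>grsum\<close>.\<close>

lemma forest_induct [case_names empty union Node]:
  assumes "P {#}" "\<And>F G. P F \<Longrightarrow> P G \<Longrightarrow> P (F + G)" "\<And>cs. P cs \<Longrightarrow> P {#Node cs#}"
  shows "P F"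
proof -
  have *: "(\<And>t. t \<in># G \<Longrightarrow> P {#t#}) \<Longrightarrow> P G" for G
  proof (induction G)
    case (add t G)
    then show ?case using assms(2)[of "{#t#}" G] by simp
  qed (simp add: assms(1))
  have "P {#t#}" for t
    by (induction t) (use * assms(3) in blast)
  then show ?thesis by (rule *)
qed

lemma cosum_coassoc:
  "cosum F (\<lambda>A B. cosum A (\<lambda>A1 A2. \<phi> A1 A2 B)) = cosum F (\<lambda>A B. cosum B (\<lambda>B1 B2. \<phi> A B1 B2))"
proof (induction F arbitrary: \<phi> rule: forest_induct)
  case (union F G)
  have "cosum (F + G) (\<lambda>A B. cosum A (\<lambda>A1 A2. \<phi> A1 A2 B))
      = cosum F (\<lambda>A B. cosum G (\<lambda>C D. cosum A (\<lambda>A1 A2. cosum C (\<lambda>C1 C2. \<phi> (A1 + C1) (A2 + C2) (B + D)))))"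
    by (simp only: cosum_union)
  \<comment> \<open>The independent sums over cuts of \<open>A\<close> and of \<open>G\<close> are
    exchanged so that each hypothesis meets its own double sum.\<close>
  also have "\<dots> = cosum F (\<lambda>A B. cosum A (\<lambda>A1 A2. cosum G (\<lambda>C D. cosum C (\<lambda>C1 C2. \<phi> (A1 + C1) (A2 + C2) (B + D)))))"
    by (subst cosum_swap[of G]) (rule refl)
  also have "\<dots> = cosum F (\<lambda>A B. cosum B (\<lambda>B1 B2. cosum G (\<lambda>C D. cosum D (\<lambda>D1 D2. \<phi> (A + C) (B1 + D1) (B2 + D2)))))"
    by (simp only: union)
  also have "\<dots> = cosum F (\<lambda>A B. cosum G (\<lambda>C D. cosum B (\<lambda>B1 B2. cosum D (\<lambda>D1 D2. \<phi> (A + C) (B1 + D1) (B2 + D2)))))"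
    by (subst cosum_swap[of G]) (rule refl)
  also have "\<dots> = cosum (F + G) (\<lambda>A B. cosum B (\<lambda>B1 B2. \<phi> A B1 B2))"
    by (simp only: cosum_union)
  finally show ?case .
next
  case (Node cs)
  show ?case by (simp add: cosum_Node cosum_plus Node add.assoc)
qed simp

section \<open>Grafting and its compatibility with cuts\<close>

lemma graftF_empty [simp]: "graftF M {#} = {#}"
  by (simp add: graftF_def)

lemma grsum_empty [simp]: "grsum M {#} \<phi> = 0"
  by (simp add: grsum_def)

lemma grsum_zero [simp]: "grsum M N (\<lambda>C. 0) = 0"
  by (simp add: grsum_def)

lemma grsum_plus: "grsum M N (\<lambda>C. \<phi> C + \<psi> C) = grsum M N \<phi> + grsum M N \<psi>"
  by (simp add: grsum_def sum_mset.distrib)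

lemma cosum_grsum_swap:
  "cosum F (\<lambda>A B. grsum M N (\<phi> A B)) = grsum M N (\<lambda>C. cosum F (\<lambda>A B. \<phi> A B C))"
  unfolding cosum_def grsum_def by (rule sum_mset.swap)

lemma sum_mset_sum_mset:
  "(\<Sum>x\<in>#sum_mset M. f x) = (\<Sum>N\<in>#M. \<Sum>x\<in>#N. f x)"
  for f :: "_ \<Rightarrow> 'b::comm_monoid_add"
  by (induction M) simp_all

lemma grsum_graftT:
  "grsum M N \<phi> = (\<Sum>t\<in>#N. \<Sum>g\<in>#graftT M t. \<phi> (add_mset g (N - {#t#})))"
  by (simp add: grsum_def graftF_def sum_mset_sum_mset image_mset.compositionality comp_def)

text \<open>The chosen vertex lies in \<open>N\<close> or in \<open>K\<close>: before division by
  the weight, grafting is a derivation in its right argument.\<close>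

lemma grsum_union:
  "grsum M (N + K) \<phi> = grsum M N (\<lambda>C. \<phi> (C + K)) + grsum M K (\<lambda>C. \<phi> (N + C))"
proof -
  have "(\<Sum>t\<in>#N. \<Sum>g\<in>#graftT M t. \<phi> (add_mset g (N + K - {#t#})))
      = (\<Sum>t\<in>#N. \<Sum>g\<in>#graftT M t. \<phi> (add_mset g (N - {#t#} + K)))"
    by (intro arg_cong[where f = sum_mset] image_mset_cong) simp
  moreover have "(\<Sum>t\<in>#K. \<Sum>g\<in>#graftT M t. \<phi> (add_mset g (N + K - {#t#})))
      = (\<Sum>t\<in>#K. \<Sum>g\<in>#graftT M t. \<phi> (N + add_mset g (K - {#t#})))"
    by (intro arg_cong[where f = sum_mset] image_mset_cong) simp
  ultimately show ?thesis by (simp add: grsum_graftT)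
qed

lemma grsum_Node:
  "grsum M {#Node cs#} \<phi> = \<phi> {#Node (cs + M)#} + grsum M cs (\<lambda>C. \<phi> {#Node C#})"
  by (simp add: grsum_graftT sum_mset_sum_mset image_mset.compositionality comp_def)

text \<open>A cut of the graft of \<open>M\<close> at a vertex \<open>v\<close> either separates \<open>v\<close>, and \<open>M\<close> with it, from the
  root, or keeps \<open>v\<close> and cuts \<open>M\<close> independently of \<open>N\<close>.\<close>

lemma grsum_cosum:
  "grsum M N (\<lambda>C. cosum C \<phi>) = cosum N (\<lambda>A B. grsum M A (\<lambda>C. \<phi> C B))
     + cosum N (\<lambda>A B. cosum M (\<lambda>K L. grsum L B (\<lambda>C. \<phi> (K + A) C)))"
proof (induction N arbitrary: \<phi> rule: forest_induct)
  case (union F G)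
  show ?case
    by (simp only: grsum_union cosum_union union cosum_grsum_swap[symmetric] cosum_plus
        cosum_swap[of M G] cosum_swap[of M F] cosum_swap[of G F] add_ac)
next
  case (Node cs)
  show ?case
    by (simp add: cosum_Node grsum_Node grsum_plus cosum_plus Node cosum_union cosum_swap[of M cs] add_ac)
qed simp

section \<open>Weight grading, counit, reduced coproduct\<close>

lemma weight_simps [simp]:
  "weight {#} = 0" "weight (F + G) = weight F + weight G" "weight {#Node cs#} = Suc (weight cs)"
  by (simp_all add: weight_def)

lemma weight_eq_0_iff [simp]: "weight F = 0 \<longleftrightarrow> F = {#}"
proof -
  have "nv t \<noteq> 0" for t by (cases t) simp
  then show ?thesis by (cases F) (simp_all add: weight_def)
qed

text \<open>Homogeneity of the coproduct. The total weight enters the form as an argument so that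
  the induction can shift it by a constant.\<close>

lemma cosum_weight:
  "cosum F (\<lambda>A B. \<phi> (weight A + weight B) A B) = cosum F (\<lambda>A B. \<phi> (weight F) A B)"
proof (induction F arbitrary: \<phi> rule: forest_induct)
  case (union F G)
  have "cosum (F + G) (\<lambda>A B. \<phi> (weight A + weight B) A B)
     = cosum F (\<lambda>A B. cosum G (\<lambda>C D. \<phi> ((weight A + weight B) + (weight C + weight D)) (A + C) (B + D)))"
    by (simp add: cosum_union add_ac)
  also have "\<dots> = cosum F (\<lambda>A B. cosum G (\<lambda>C D. \<phi> (weight F + weight G) (A + C) (B + D)))"
    using union(2)[of "\<lambda>n C D. \<phi> (weight A + weight B + n) (A + C) (B + D)" for A B]
      union(1)[of "\<lambda>n A B. cosum G (\<lambda>C D. \<phi> (n + weight G) (A + C) (B + D))"] by simp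
  finally show ?case by (simp add: cosum_union)
next
  case (Node cs)
  from Node[of "\<lambda>n A B. \<phi> (Suc n) A {#Node B#}"] show ?case by (simp add: cosum_Node)
qed simp

lemma count_coF: "of_nat (count (coF F) (A, B)) = cosum F (\<lambda>C D. if C = A \<and> D = B then 1 else 0)"
proof -
  have "of_nat (count M (A, B)) = (\<Sum>p\<in>#M. if fst p = A \<and> snd p = B then 1 else (0::rat))" for M
    by (induction M) auto
  then show ?thesis by (simp add: cosum_def)
qed

lemma weight_coF:
  assumes "(A, B) \<in># coF F"
  shows "weight A + weight B = weight F"
proof (rule ccontr)
  assume neq: "weight A + weight B \<noteq> weight F"
  \<comment> \<open>The indicator of \<open>(A, B)\<close> is padded with a weight condition that
    holds wherever it is nonzero; \<open>cosum_weight\<close> then turns this condition into a false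
    one.\<close>
  have "rat_of_nat (count (coF F) (A, B))
      = cosum F (\<lambda>C D. if C = A \<and> D = B \<and> weight C + weight D = weight A + weight B then 1 else 0)"
    unfolding count_coF by (intro arg_cong[where f = "cosum F"] ext) auto
  also have "\<dots> = 0"
    using neq cosum_weight[of F "\<lambda>n C D. if C = A \<and> D = B \<and> n = weight A + weight B then 1 else 0"]
    by simp
  finally show False using assms by (simp add: not_in_iff[symmetric])
qed

lemma cosum_cong:
  assumes "\<And>A B. weight A + weight B = weight F \<Longrightarrow> \<phi> A B = \<psi> A B"
  shows "cosum F \<phi> = cosum F \<psi>"
  unfolding cosum_def
  by (intro arg_cong[where f = sum_mset] image_mset_cong assms weight_coF) simp

lemma cosum_if: "cosum F (\<lambda>A B. if b then \<phi> A B else 0) = (if b then cosum F \<phi> else 0)"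
  by simp

lemma cosum_counit_left: "cosum F (\<lambda>A B. if A = {#} then \<phi> B else 0) = \<phi> F"
proof (induction F arbitrary: \<phi> rule: forest_induct)
  case (union F G)
  have "cosum (F + G) (\<lambda>A B. if A = {#} then \<phi> B else 0)
      = cosum F (\<lambda>A B. cosum G (\<lambda>C D. if A = {#} then (if C = {#} then \<phi> (B + D) else 0) else 0))"
    unfolding cosum_union by (intro arg_cong[where f = "cosum _"] ext) simp
  then show ?case by (simp only: cosum_if union)
qed (simp_all add: cosum_Node)

lemma cosum_counit_right: "cosum F (\<lambda>A B. if B = {#} then \<phi> A else 0) = \<phi> F"
proof (induction F arbitrary: \<phi> rule: forest_induct)
  case (union F G)
  have "cosum (F + G) (\<lambda>A B. if B = {#} then \<phi> A else 0)
      = cosum F (\<lambda>A B. cosum G (\<lambda>C D. if B = {#} then (if D = {#} then \<phi> (A + C) else 0) else 0))"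
    unfolding cosum_union by (intro arg_cong[where f = "cosum _"] ext) simp
  then show ?case by (simp only: cosum_if union)
qed (simp_all add: cosum_Node)

text \<open>Dropping the terms with a trivial factor gives the reduced coproduct for
  \<open>F \<noteq> {#}\<close>; at \<open>F = {#}\<close> the result is 0, whereas the reduced
  coproduct of 1 is \<open>- 1 \<otimes> 1\<close>.\<close>

definition redsum :: "forest \<Rightarrow> (forest \<Rightarrow> forest \<Rightarrow> rat) \<Rightarrow> rat" where
  "redsum F \<phi> = cosum F (\<lambda>A B. if A = {#} \<or> B = {#} then 0 else \<phi> A B)"

lemma cosum_redsum:
  assumes "F \<noteq> {#}"
  shows "cosum F \<phi> = \<phi> {#} F + \<phi> F {#} + redsum F \<phi>"
proof -
  have "cosum F \<phi> = cosum F (\<lambda>A B. (if A = {#} then \<phi> {#} B else 0) + (if B = {#} then \<phi> A {#} else 0)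
          + (if A = {#} \<or> B = {#} then 0 else \<phi> A B))"
    using assms by (intro cosum_cong) auto
  then show ?thesis
    by (simp only: cosum_plus cosum_counit_left cosum_counit_right redsum_def)
qed

text \<open>Both factors of a reduced term are lighter than \<open>F\<close>, which drives the later
  inductions on weight.\<close>

lemma redsum_cong:
  assumes "\<And>A B. A \<noteq> {#} \<Longrightarrow> B \<noteq> {#} \<Longrightarrow> weight A < weight F \<Longrightarrow> weight B < weight F \<Longrightarrow> \<phi> A B = \<psi> A B"
  shows "redsum F \<phi> = redsum F \<psi>"
  unfolding redsum_def
proof (rule cosum_cong)
  fix A B
  assume "weight A + weight B = weight F"
  moreover have "A \<noteq> {#} \<Longrightarrow> weight A > 0" "B \<noteq> {#} \<Longrightarrow> weight B > 0"
    by (metis gr0I weight_eq_0_iff)+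
  ultimately show "(if A = {#} \<or> B = {#} then 0 else \<phi> A B) = (if A = {#} \<or> B = {#} then 0 else \<psi> A B)"
    using assms by auto
qed

lemma redsum_zero [simp]: "redsum F (\<lambda>A B. 0) = 0"
  by (simp add: redsum_def)

lemma redsum_plus: "redsum F (\<lambda>A B. \<phi> A B + \<psi> A B) = redsum F \<phi> + redsum F \<psi>"
  unfolding redsum_def cosum_plus[symmetric] by (intro arg_cong[where f = "cosum F"] ext) simp

lemma grsum_nonempty: "grsum M N (\<lambda>C. if C = {#} then \<phi> C else \<psi> C) = grsum M N \<psi>"
  by (simp add: grsum_graftT)

lemma grsum_empty_left: "grsum {#} N \<phi> = of_nat (weight N) * \<phi> N"
  by (induction N arbitrary: \<phi> rule: forest_induct) (simp_all add: grsum_union grsum_Node algebra_simps)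

section \<open>Linear forms on finitely supported functions\<close>

text \<open>The linear form with values \<open>f\<close> on the basis, applied to \<open>x\<close>;
  it is meaningful for finite support, an infinite one giving 0.\<close>

definition pair :: "('a \<Rightarrow> rat) \<Rightarrow> ('a \<Rightarrow> rat) \<Rightarrow> rat" where
  "pair x f = (\<Sum>a\<in>supp x. x a * f a)"

lemma pair_superset:
  assumes "finite S" "supp x \<subseteq> S"
  shows "pair x f = (\<Sum>a\<in>S. x a * f a)"
  unfolding pair_def using assms by (intro sum.mono_neutral_left) (auto simp: supp_def)

lemma supp_hsub: "supp (hsub x y) \<subseteq> supp x \<union> supp y"
  and supp_hadd: "supp (hadd x y) \<subseteq> supp x \<union> supp y"
  and supp_hscale: "supp (hscale c x) \<subseteq> supp x"
  by (auto simp: supp_def hsub_def hadd_def hscale_def)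

lemma finsupp_hsub [simp]: "finsupp x \<Longrightarrow> finsupp y \<Longrightarrow> finsupp (hsub x y)"
  and finsupp_hadd [simp]: "finsupp x \<Longrightarrow> finsupp y \<Longrightarrow> finsupp (hadd x y)"
  and finsupp_hscale [simp]: "finsupp x \<Longrightarrow> finsupp (hscale c x)"
  using finite_subset[OF supp_hsub] finite_subset[OF supp_hadd] finite_subset[OF supp_hscale]
  by (auto simp: finsupp_def)

lemma finsupp_zero [simp]: "finsupp (\<lambda>_. 0)"
  by (simp add: finsupp_def supp_def)

lemma supp_basis [simp]: "supp (basis a) = {a}"
  by (auto simp: supp_def basis_def)

lemma finsupp_basis [simp]: "finsupp (basis a)"
  by (simp add: finsupp_def)

lemma pair_basis_left [simp]: "pair (basis a) f = f a"
  by (simp add: pair_def) (simp add: basis_def)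

lemma pair_zero_left [simp]: "pair (\<lambda>_. 0) f = 0"
  by (simp add: pair_def)

lemma pair_zero_right [simp]: "pair x (\<lambda>_. 0) = 0"
  by (simp add: pair_def)

lemma pair_hsub:
  assumes "finsupp x" "finsupp y"
  shows "pair (hsub x y) f = pair x f - pair y f"
proof -
  have "finite (supp x \<union> supp y)" using assms by (simp add: finsupp_def)
  then show ?thesis
    using pair_superset[of "supp x \<union> supp y"] supp_hsub[of x y]
    by (simp add: sum_subtractf[symmetric] left_diff_distrib) (simp add: hsub_def left_diff_distrib)
qed

lemma pair_hadd:
  assumes "finsupp x" "finsupp y"
  shows "pair (hadd x y) f = pair x f + pair y f"
proof -
  have "finite (supp x \<union> supp y)" using assms by (simp add: finsupp_def)
  then show ?thesis
    using pair_superset[of "supp x \<union> supp y"] supp_hadd[of x y]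
    by (simp add: sum.distrib[symmetric]) (simp add: hadd_def distrib_right)
qed

lemma pair_hscale:
  assumes "finsupp x"
  shows "pair (hscale c x) f = c * pair x f"
  using assms pair_superset[of "supp x" "hscale c x" f, OF _ supp_hscale]
  by (simp add: finsupp_def) (simp add: pair_def hscale_def sum_distrib_left mult.assoc)

lemma pair_plus: "pair x (\<lambda>a. f a + g a) = pair x f + pair x g"
  by (simp add: pair_def distrib_left sum.distrib)

lemma pair_sum_mset: "pair x (\<lambda>a. \<Sum>b\<in>#M. f a b) = (\<Sum>b\<in>#M. pair x (\<lambda>a. f a b))"
  by (induction M) (simp_all add: pair_plus)

lemma pair_basis_right: "finsupp x \<Longrightarrow> pair x (basis a) = x a"
  using sum.mono_neutral_right[of "insert a (supp x)" "{a}" "\<lambda>b. x b * basis a b"]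
  by (subst pair_superset[of "insert a (supp x)"]) (auto simp: finsupp_def basis_def)

lemma pair_ext:
  assumes "finsupp x" "finsupp y" "\<And>f. pair x f = pair y f"
  shows "x = y"
  using assms(3)[of "basis a" for a] assms(1,2) by (auto simp: pair_basis_right)

lemma supp_pair:
  fixes x :: "'a \<Rightarrow> rat" and k :: "'a \<Rightarrow> 'b \<Rightarrow> rat"
  shows "supp (\<lambda>b. pair x (\<lambda>a. k a b)) \<subseteq> (\<Union>a\<in>supp x. supp (k a))"
proof
  fix b
  assume "b \<in> supp (\<lambda>b. pair x (\<lambda>a. k a b))"
  then obtain a where "a \<in> supp x" "x a * k a b \<noteq> 0"
    unfolding pair_def supp_def[of "\<lambda>b. _ b"] by (auto elim: sum.not_neutral_contains_not_neutral)
  then show "b \<in> (\<Union>a\<in>supp x. supp (k a))" by (auto simp: supp_def)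
qed

lemma finsupp_pair:
  fixes x :: "'a \<Rightarrow> rat" and k :: "'a \<Rightarrow> 'b \<Rightarrow> rat"
  assumes "finsupp x" "\<And>a. finsupp (k a)"
  shows "finsupp (\<lambda>b. pair x (\<lambda>a. k a b))"
  using assms finite_subset[OF supp_pair[of x k]] by (simp add: finsupp_def)

text \<open>A form composed with the linear map of matrix \<open>k\<close>: all rows that occur are
  supported in one finite set \<open>S\<close>, so the sums can be exchanged.\<close>

lemma pair_pair:
  fixes x :: "'a \<Rightarrow> rat" and k :: "'a \<Rightarrow> 'b \<Rightarrow> rat"
  assumes "finsupp x" "\<And>a. finsupp (k a)"
  shows "pair (\<lambda>b. pair x (\<lambda>a. k a b)) f = pair x (\<lambda>a. pair (k a) f)"
proof -
  define S where "S = (\<Union>a\<in>supp x. supp (k a))"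
  have S: "finite S" "\<And>a. a \<in> supp x \<Longrightarrow> supp (k a) \<subseteq> S"
    using assms by (auto simp: S_def finsupp_def)
  have "pair (\<lambda>b. pair x (\<lambda>a. k a b)) f = (\<Sum>b\<in>S. pair x (\<lambda>a. k a b) * f b)"
    using S supp_pair[of x k] by (intro pair_superset) (auto simp: S_def)
  also have "\<dots> = (\<Sum>a\<in>supp x. x a * (\<Sum>b\<in>S. k a b * f b))"
    unfolding pair_def sum_distrib_left sum_distrib_right by (subst sum.swap) (simp add: mult_ac)
  also have "\<dots> = pair x (\<lambda>a. pair (k a) f)"
    unfolding pair_def[of x] using S by (intro sum.cong) (simp_all add: pair_superset)
  finally show ?thesis .
qed

lemma supp_count: "supp (\<lambda>p. of_nat (count M p)) = set_mset M"
  by (auto simp: supp_def)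

lemma finsupp_count [simp]: "finsupp (\<lambda>p. of_nat (count M p))"
  by (simp add: finsupp_def supp_count)

lemma pair_count: "pair (\<lambda>p. of_nat (count M p)) f = (\<Sum>p\<in>#M. f p)"
proof (induction M)
  case (add a M)
  have "(\<lambda>p. of_nat (count (add_mset a M) p)) = hadd (basis a) (\<lambda>p. of_nat (count M p))"
    by (auto simp: hadd_def basis_def)
  then show ?case using add by (simp add: pair_hadd)
qed simp

lemma finsupp_sum_mset:
  assumes "\<And>p. p \<in># M \<Longrightarrow> finsupp (k p)"
  shows "finsupp (\<lambda>c. \<Sum>p\<in>#M. k p c)"
  using assms
proof (induction M)
  case (add p M)
  have "(\<lambda>c. \<Sum>q\<in>#add_mset p M. k q c) = hadd (k p) (\<lambda>c. \<Sum>q\<in>#M. k q c)"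
    by (simp add: hadd_def)
  with add show ?case by simp
qed simp

lemma pair_sum_mset_left:
  assumes "\<And>p. p \<in># M \<Longrightarrow> finsupp (k p)"
  shows "pair (\<lambda>c. \<Sum>p\<in>#M. k p c) f = (\<Sum>p\<in>#M. pair (k p) f)"
  using assms
proof (induction M)
  case (add p M)
  have "(\<lambda>c. \<Sum>q\<in>#add_mset p M. k q c) = hadd (k p) (\<lambda>c. \<Sum>q\<in>#M. k q c)"
    by (simp add: hadd_def)
  with add show ?case by (simp add: pair_hadd finsupp_sum_mset)
qed simp

section \<open>The operation \<open>\<top>\<close> in dual form\<close>

text \<open>At \<open>B = {#}\<close> both sides are 0, since \<open>graftF A {#}\<close> is
  empty.\<close>

lemma topF_eq: "topF A B = hscale (1 / of_nat (weight B)) (\<lambda>C. of_nat (count (graftF A B) C))"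
  by (auto simp: topF_def hscale_def)

lemma finsupp_topF [simp]: "finsupp (topF A B)"
  by (simp add: topF_eq)

lemma pair_topF: "pair (topF A B) \<phi> = grsum A B \<phi> / of_nat (weight B)"
  by (simp add: topF_eq pair_hscale pair_count grsum_def)

lemma top_eq: "top x y = (\<lambda>C. pair x (\<lambda>A. pair y (\<lambda>B. topF A B C)))"
  by (simp add: top_def pair_def sum_distrib_left mult.assoc)

lemma finsupp_top [simp]: "finsupp x \<Longrightarrow> finsupp y \<Longrightarrow> finsupp (top x y)"
  unfolding top_eq by (intro finsupp_pair) simp_all

text \<open>The value of the form \<open>\<phi>\<close> at \<open>A \<top> y\<close>.\<close>

definition attach :: "H \<Rightarrow> forest \<Rightarrow> (forest \<Rightarrow> rat) \<Rightarrow> rat" where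
  "attach y A \<phi> = pair y (\<lambda>B. grsum A B \<phi> / of_nat (weight B))"

lemma pair_top:
  assumes "finsupp x" "finsupp y"
  shows "pair (top x y) \<phi> = pair x (\<lambda>A. attach y A \<phi>)"
  using assms by (simp add: top_eq pair_pair finsupp_pair pair_topF attach_def)

lemma top_empty [simp]: "top x y {#} = 0"
proof -
  have "{#} \<notin># graftF A B" for A B
    by (auto simp: graftF_def)
  then have "topF A B {#} = 0" for A B
    by (simp add: topF_def not_in_iff)
  then show ?thesis by (simp add: top_eq)
qed

lemma attach_zero_left [simp]: "attach (\<lambda>_. 0) A \<phi> = 0"
  by (simp add: attach_def)

lemma attach_zero_right [simp]: "attach y A (\<lambda>_. 0) = 0"
  by (simp add: attach_def)

lemma pair_cong: "(\<And>a. x a \<noteq> 0 \<Longrightarrow> f a = g a) \<Longrightarrow> pair x f = pair x g"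
  unfolding pair_def by (intro sum.cong) (auto simp: supp_def)

text \<open>The weight cancels the number of vertices, except on the constant term, where
  \<open>1 \<top> 1 = 0\<close>; hence the hypothesis.\<close>

lemma attach_empty: "y {#} = 0 \<Longrightarrow> attach y {#} \<phi> = pair y \<phi>"
  unfolding attach_def by (rule pair_cong) (auto simp: grsum_empty_left)

lemma attach_nonempty: "attach y A (\<lambda>C. if C = {#} then \<psi> C else \<phi> C) = attach y A \<phi>"
  by (simp add: attach_def grsum_nonempty)

section \<open>Primitive elements\<close>

text \<open>Writing all three terms as matrices on the basis makes \<open>pair_pair\<close>
  applicable.\<close>

lemma DeltaRed_eq:
  "DeltaRed x = hsub (hsub (\<lambda>p. pair x (\<lambda>G. DeltaF G p)) (\<lambda>p. pair x (\<lambda>G. basis ({#}, G) p)))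
     (\<lambda>p. pair x (\<lambda>G. basis (G, {#}) p))"
  if "finsupp x"
proof -
  have "pair x (\<lambda>G. basis ({#}, G) p) = tens one x p" for p
  proof (cases p)
    case (Pair A B)
    have "pair x (\<lambda>G. basis ({#}, G) p) = pair x (if A = {#} then basis B else (\<lambda>_. 0))"
      by (rule arg_cong[where f = "pair x"]) (auto simp: basis_def Pair)
    also have "\<dots> = (if A = {#} then x B else 0)"
      using that by (simp add: pair_basis_right)
    also have "\<dots> = tens one x p"
      by (simp add: Pair tens_def one_def basis_def)
    finally show ?thesis .
  qed
  moreover have "pair x (\<lambda>G. basis (G, {#}) p) = tens x one p" for p
  proof (cases p)
    case (Pair A B)
    have "pair x (\<lambda>G. basis (G, {#}) p) = pair x (if B = {#} then basis A else (\<lambda>_. 0))"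
      by (rule arg_cong[where f = "pair x"]) (auto simp: basis_def Pair)
    also have "\<dots> = (if B = {#} then x A else 0)"
      using that by (simp add: pair_basis_right)
    also have "\<dots> = tens x one p"
      by (simp add: Pair tens_def one_def basis_def)
    finally show ?thesis .
  qed
  ultimately show ?thesis by (simp add: DeltaRed_def Delta_def pair_def[of x "\<lambda>G. DeltaF G _"])
qed

lemma finsupp_DeltaF [simp]: "finsupp (DeltaF G)"
  by (simp add: DeltaF_def)

lemma finsupp_DeltaRed: "finsupp x \<Longrightarrow> finsupp (DeltaRed x)"
  by (simp add: DeltaRed_eq finsupp_pair)

lemma pair_DeltaRed:
  assumes "finsupp x"
  shows "pair (DeltaRed x) \<Phi> = pair x (\<lambda>G. cosum G (\<lambda>A B. \<Phi> (A, B)))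
    - pair x (\<lambda>G. \<Phi> ({#}, G)) - pair x (\<lambda>G. \<Phi> (G, {#}))"
  using assms
  by (simp add: DeltaRed_eq pair_hsub finsupp_pair pair_pair DeltaF_def[abs_def] pair_count cosum_def)

lemma Prim_finsupp: "p \<in> Prim \<Longrightarrow> finsupp p"
  by (simp add: Prim_def)

lemma PrimD:
  assumes "p \<in> Prim"
  shows "pair p (\<lambda>G. cosum G \<phi>) = pair p (\<lambda>G. \<phi> {#} G) + pair p (\<lambda>G. \<phi> G {#})"
  using pair_DeltaRed[of p "\<lambda>q. \<phi> (fst q) (snd q)"] assms by (simp add: Prim_def)

lemma PrimI:
  assumes "finsupp p"
    and "\<And>\<phi>. pair p (\<lambda>G. cosum G \<phi>) = pair p (\<lambda>G. \<phi> {#} G) + pair p (\<lambda>G. \<phi> G {#})"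
  shows "p \<in> Prim"
proof -
  have "DeltaRed p = (\<lambda>_. 0)"
    using assms(1)
    by (intro pair_ext) (simp_all add: finsupp_DeltaRed pair_DeltaRed assms(2))
  with assms(1) show ?thesis by (simp add: Prim_def)
qed

text \<open>With the counit on the left factor and the coefficient of 1 on the right, primitivity
  says that this coefficient of \<open>p\<close> is twice itself.\<close>

lemma Prim_empty:
  assumes "p \<in> Prim"
  shows "p {#} = 0"
proof -
  have "(\<lambda>G :: forest. if G = {#} then basis ({#} :: forest) {#} else 0) = basis {#}"
    by (auto simp: basis_def)
  then have "pair p (basis {#}) = pair p (basis {#}) + pair p (basis {#})"
    using PrimD[OF assms, of "\<lambda>A B. if A = {#} then basis {#} B else 0"]
    by (simp only: simp_thms if_True cosum_counit_left)
  then have "pair p (basis {#}) = 0" by (simp only: add_cancel_right_right)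
  then show ?thesis using assms by (simp add: pair_basis_right Prim_finsupp)
qed

text \<open>The coproduct preserves weight, so dividing every homogeneous component by its weight preserves
  primitivity; this absorbs the factor \<open>1 / weight N\<close> in \<open>M \<top> N\<close>.\<close>

lemma PrimD_weight:
  assumes "p \<in> Prim"
  shows "pair p (\<lambda>G. cosum G \<phi> / of_nat (weight G))
    = pair p (\<lambda>G. \<phi> {#} G / of_nat (weight G)) + pair p (\<lambda>G. \<phi> G {#} / of_nat (weight G))"
proof -
  have "cosum G (\<lambda>A B. \<phi> A B / of_nat (weight A + weight B)) = cosum G \<phi> / of_nat (weight G)" for G
    unfolding cosum_weight[of G "\<lambda>n A B. \<phi> A B / of_nat n"]
    by (simp add: cosum_def sum_mset_distrib_right divide_inverse)
  then show ?thesis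
    using PrimD[OF assms, of "\<lambda>A B. \<phi> A B / of_nat (weight A + weight B)"] by simp
qed

text \<open>This is the identity \<open>\<Delta>(x \<top> p) = (x \<top> p) \<otimes> 1 + (id \<otimes> (\<cdot> \<top> p)) (\<Delta> x)\<close> for primitive \<open>p\<close>.\<close>

lemma attach_cosum:
  assumes "p \<in> Prim"
  shows "attach p M (\<lambda>C. cosum C \<phi>)
    = attach p M (\<lambda>C. \<phi> C {#}) + cosum M (\<lambda>K L. attach p L (\<phi> K))"
proof -
  define \<psi> where "\<psi> A B = grsum M A (\<lambda>C. \<phi> C B) + cosum M (\<lambda>K L. grsum L B (\<lambda>C. \<phi> (K + A) C))" for A B
  have "attach p M (\<lambda>C. cosum C \<phi>) = pair p (\<lambda>B. cosum B \<psi> / of_nat (weight B))"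
    unfolding attach_def grsum_cosum \<psi>_def cosum_plus ..
  also have "\<dots> = pair p (\<lambda>G. \<psi> {#} G / of_nat (weight G)) + pair p (\<lambda>G. \<psi> G {#} / of_nat (weight G))"
    by (rule PrimD_weight[OF assms])
  \<comment> \<open>Primitivity has left only \<open>({#}, G)\<close> and \<open>(G, {#})\<close>;
    grafting onto the empty forest gives 0, so each keeps one summand of
    \<open>\<psi>\<close>.\<close>
  also have "pair p (\<lambda>G. \<psi> G {#} / of_nat (weight G)) = attach p M (\<lambda>C. \<phi> C {#})"
    by (simp add: \<psi>_def attach_def)
  also have "pair p (\<lambda>G. \<psi> {#} G / of_nat (weight G)) = cosum M (\<lambda>K L. attach p L (\<phi> K))"
    by (simp add: \<psi>_def attach_def cosum_def pair_sum_mset[symmetric] sum_mset_distrib_right divide_inverse)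
  finally show ?thesis by simp
qed

section \<open>The recursively defined projection\<close>

function piF :: "forest \<Rightarrow> H" where
  "piF F = (if F = {#} then (\<lambda>_. 0) else (\<lambda>C. basis F C -
     (\<Sum>p\<in>#coF F. if fst p = {#} \<or> snd p = {#} then 0 else top (basis (fst p)) (piF (snd p)) C)))"
  by auto
termination
proof (relation "measure weight")
  fix F :: forest and p
  assume "p \<in># coF F" "\<not> (fst p = {#} \<or> snd p = {#})"
  \<comment> \<open>A nonempty \<open>fst p\<close> has positive weight, so \<open>snd p\<close> is
    lighter than \<open>F\<close>.\<close>
  then show "(snd p, F) \<in> measure weight"
    using weight_coF[of "fst p" "snd p" F] weight_eq_0_iff[of "fst p"] by (auto simp del: weight_eq_0_iff)
qed simp

declare piF.simps [simp del]

lemma piF_empty [simp]: "piF {#} = (\<lambda>_. 0)"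
  by (simp add: piF.simps)

lemma piF_apply:
  "F \<noteq> {#} \<Longrightarrow> piF F C = basis F C - redsum F (\<lambda>A B. top (basis A) (piF B) C)"
  by (subst piF.simps) (simp add: redsum_def cosum_def)

lemma piF_at_empty [simp]: "piF F {#} = 0"
  by (cases "F = {#}") (simp_all add: piF_apply redsum_def basis_def)

lemma forest_weight_induct [case_names less]:
  assumes "\<And>F. (\<And>G. weight G < weight F \<Longrightarrow> P G) \<Longrightarrow> P F"
  shows "P F"
  using assms by (rule measure_induct_rule[of weight])

lemma piF_eq:
  "F \<noteq> {#} \<Longrightarrow> piF F = hsub (basis F) (\<lambda>C. \<Sum>p\<in>#coF F. (if fst p = {#} \<or> snd p = {#} then (\<lambda>_. 0)
     else top (basis (fst p)) (piF (snd p))) C)"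
  by (rule ext) (simp add: piF_apply hsub_def redsum_def cosum_def if_distribR)

lemma finsupp_piF [simp]: "finsupp (piF F)"
proof (induction F rule: forest_weight_induct)
  case (less F)
  have "finsupp (piF (snd p))" if "p \<in># coF F" "fst p \<noteq> {#}" for p
    using that weight_coF[of "fst p" "snd p" F] weight_eq_0_iff[of "fst p"]
    by (intro less) (auto simp del: weight_eq_0_iff)
  then show ?case
    by (cases "F = {#}") (auto simp: piF_eq[of F] intro!: finsupp_hsub finsupp_sum_mset)
qed

lemma pair_piF:
  assumes "F \<noteq> {#}"
  shows "pair (piF F) \<phi> = \<phi> F - redsum F (\<lambda>A B. attach (piF B) A \<phi>)"
proof -
  let ?k = "\<lambda>p. if fst p = {#} \<or> snd p = {#} then (\<lambda>_. 0) else top (basis (fst p)) (piF (snd p))"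
  have fin: "finsupp (?k p)" for p by simp
  have "pair (\<lambda>C. \<Sum>p\<in>#coF F. ?k p C) \<phi> = (\<Sum>p\<in>#coF F. pair (?k p) \<phi>)"
    by (rule pair_sum_mset_left) (rule fin)
  also have "\<dots> = redsum F (\<lambda>A B. attach (piF B) A \<phi>)"
    unfolding redsum_def cosum_def
    by (intro arg_cong[where f = sum_mset] image_mset_cong) (simp add: pair_top)
  finally show ?thesis
    using assms finsupp_sum_mset[of "coF F" ?k, OF fin] by (simp add: piF_eq pair_hsub)
qed

text \<open>The defining recursion of \<open>piF\<close> in closed form: \<open>\<top> \<circ> (id \<otimes> \<pi>) \<circ> \<Delta> = id - \<epsilon>\<close>.\<close>

lemma cosum_attach_piF: "cosum F (\<lambda>A B. attach (piF B) A \<phi>) = (if F = {#} then 0 else \<phi> F)"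
  by (simp add: cosum_redsum attach_empty pair_piF)

text \<open>A form of the coproduct is applied to the recursion. Lighter \<open>piF B\<close> are
  primitive, so \<open>attach_cosum\<close> expands each \<open>A \<top> piF B\<close>;
  coassociativity then moves the inner cut to the second factor, where the closed recursion
  evaluates it.\<close>

lemma piF_Prim: "piF F \<in> Prim"
proof (induction F rule: forest_weight_induct)
  case (less F)
  show ?case
  proof (rule PrimI)
    fix \<phi> :: "forest \<Rightarrow> forest \<Rightarrow> rat"
    show "pair (piF F) (\<lambda>G. cosum G \<phi>) = pair (piF F) (\<lambda>G. \<phi> {#} G) + pair (piF F) (\<lambda>G. \<phi> G {#})"
    proof (cases "F = {#}")
      case False
      let ?c = "\<lambda>A B. cosum A (\<lambda>K L. attach (piF B) L (\<phi> K))"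
      have "redsum F (\<lambda>A B. attach (piF B) A (\<lambda>C. cosum C \<phi>))
          = redsum F (\<lambda>A B. attach (piF B) A (\<lambda>C. \<phi> C {#}) + ?c A B)"
        by (rule redsum_cong) (simp add: attach_cosum less)
      then have "redsum F (\<lambda>A B. attach (piF B) A (\<lambda>C. cosum C \<phi>))
          = \<phi> F {#} - pair (piF F) (\<lambda>C. \<phi> C {#}) + redsum F ?c"
        using False by (simp add: redsum_plus pair_piF)
      \<comment> \<open>Of the two terms added to complete the sum, \<open>F \<otimes> 1\<close>
        contributes 0 because \<open>piF {#} = 0\<close>, and \<open>1 \<otimes> F\<close>
        contributes \<open>1 \<otimes> piF F\<close>.\<close>
      moreover have "redsum F ?c = cosum F ?c - pair (piF F) (\<phi> {#})"
        using False by (simp add: cosum_redsum[of F] attach_empty)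
      moreover have "cosum F ?c = cosum F (\<lambda>A B. if B = {#} then 0 else \<phi> A B)"
        by (simp only: cosum_coassoc[of F "\<lambda>K L B. attach (piF B) L (\<phi> K)"] cosum_attach_piF)
      moreover have "cosum F \<phi> = cosum F (\<lambda>A B. (if B = {#} then 0 else \<phi> A B) + (if B = {#} then \<phi> A {#} else 0))"
        by (rule cosum_cong) simp
      then have "cosum F \<phi> = cosum F (\<lambda>A B. if B = {#} then 0 else \<phi> A B) + \<phi> F {#}"
        by (simp only: cosum_plus cosum_counit_right)
      ultimately show ?thesis
        using pair_piF[OF False, of "\<lambda>C. cosum C \<phi>"] by simp
    qed simp
  qed simp
qed

text \<open>In the closed recursion on \<open>p\<close>, the part \<open>p \<otimes> 1\<close> of
  the coproduct is killed by \<open>piF {#} = 0\<close>, and \<open>1 \<otimes> p\<close> gives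
  \<open>1 \<top> \<pi>(p) = \<pi>(p)\<close>.\<close>

lemma Prim_piF:
  assumes "p \<in> Prim"
  shows "pair p (\<lambda>F. pair (piF F) \<phi>) = pair p \<phi>"
proof -
  have "pair p \<phi> = pair p (\<lambda>G. cosum G (\<lambda>A B. attach (piF B) A \<phi>))"
    unfolding cosum_attach_piF using Prim_empty[OF assms] by (intro pair_cong) auto
  also have "\<dots> = pair p (\<lambda>F. pair (piF F) \<phi>)"
    by (simp add: PrimD[OF assms] attach_empty)
  finally show ?thesis ..
qed

text \<open>Evaluate the closed recursion at \<open>M \<top> p\<close> through
  \<open>attach_cosum\<close>. The cut \<open>M \<otimes> 1\<close> gives
  \<open>M \<top> \<pi>(p) = M \<top> p\<close>, which cancels the left side;
  \<open>1 \<otimes> M\<close> gives \<open>\<pi>(M \<top> p)\<close>, and the remaining terms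
  vanish by induction.\<close>

lemma attach_piF_eq_0:
  assumes "p \<in> Prim" "M \<noteq> {#}"
  shows "attach p M (\<lambda>F. pair (piF F) \<phi>) = 0"
  using assms(2)
proof (induction M arbitrary: \<phi> rule: forest_weight_induct)
  case (less M)
  have "attach p M \<phi> = attach p M (\<lambda>C. cosum C (\<lambda>A B. attach (piF B) A \<phi>))"
    by (simp add: cosum_attach_piF attach_nonempty)
  also have "\<dots> = cosum M (\<lambda>K L. attach p L (\<lambda>C. attach (piF C) K \<phi>))"
    by (simp add: attach_cosum[OF assms(1)])
  also have "\<dots> = attach p M (\<lambda>C. pair (piF C) \<phi>) + attach p {#} (\<lambda>C. attach (piF C) M \<phi>)
      + redsum M (\<lambda>K L. attach p L (\<lambda>C. attach (piF C) K \<phi>))"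
    using less.prems by (simp add: cosum_redsum attach_empty)
  also have "attach p {#} (\<lambda>C. attach (piF C) M \<phi>) = attach p M \<phi>"
    unfolding attach_empty[of p, OF Prim_empty[OF assms(1)]]
    unfolding attach_def by (rule Prim_piF[OF assms(1)])
  also have "redsum M (\<lambda>K L. attach p L (\<lambda>C. attach (piF C) K \<phi>)) = redsum M (\<lambda>K L. 0)"
    \<comment> \<open>\<open>attach (piF C) K \<phi>\<close> is \<open>pair (piF C)\<close> of
      another form, so the hypothesis for the lighter \<open>L\<close>, which covers every form,
      applies.\<close>
    by (rule redsum_cong) (subst attach_def[of "piF _"], rule less.IH)
  finally show ?case by simp
qed

section \<open>Spans and the images of the maps \<open>F_j\<close>\<close>

lemma qspan_superset: "S \<subseteq> qspan S"
proof
  fix x assume "x \<in> S"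
  then show "x \<in> qspan S"
    unfolding qspan_def by (auto intro!: exI[of _ "{x}"] exI[of _ "\<lambda>_. 1"])
qed

lemma qspan_zero: "(\<lambda>_. 0) \<in> qspan S"
  unfolding qspan_def by (auto intro!: exI[of _ "{}"])

lemma qspan_hscale: "x \<in> qspan S \<Longrightarrow> hscale c x \<in> qspan S"
proof -
  assume "x \<in> qspan S"
  then obtain T d where "finite T" "T \<subseteq> S" "x = (\<lambda>a. \<Sum>v\<in>T. d v * v a)"
    unfolding qspan_def by blast
  then show "hscale c x \<in> qspan S"
    unfolding qspan_def
    by (auto intro!: exI[of _ T] exI[of _ "\<lambda>v. c * d v"] simp: hscale_def sum_distrib_left mult.assoc)
qed

lemma qspan_hadd:
  assumes "x \<in> qspan S" "y \<in> qspan S"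
  shows "hadd x y \<in> qspan S"
proof -
  obtain T c where T: "finite T" "T \<subseteq> S" "x = (\<lambda>a. \<Sum>v\<in>T. c v * v a)"
    using assms(1) unfolding qspan_def by blast
  obtain U d where U: "finite U" "U \<subseteq> S" "y = (\<lambda>a. \<Sum>v\<in>U. d v * v a)"
    using assms(2) unfolding qspan_def by blast
  define e where "e v = (if v \<in> T then c v else 0) + (if v \<in> U then d v else 0)" for v
  have "x a = (\<Sum>v\<in>T \<union> U. (if v \<in> T then c v else 0) * v a)" for a
    unfolding T(3) using T(1) U(1) by (intro sum.mono_neutral_cong_left) auto
  moreover have "y a = (\<Sum>v\<in>T \<union> U. (if v \<in> U then d v else 0) * v a)" for a
    unfolding U(3) using T(1) U(1) by (intro sum.mono_neutral_cong_left) auto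
  ultimately have "hadd x y = (\<lambda>a. \<Sum>v\<in>T \<union> U. e v * v a)"
    by (simp add: hadd_def e_def distrib_right sum.distrib)
  then show ?thesis
    unfolding qspan_def using T U by (auto intro!: exI[of _ "T \<union> U"] exI[of _ e])
qed

lemma qspan_least:
  assumes "S \<subseteq> V" "(\<lambda>_. 0) \<in> V" "\<And>x y. x \<in> V \<Longrightarrow> y \<in> V \<Longrightarrow> hadd x y \<in> V"
    "\<And>c x. x \<in> V \<Longrightarrow> hscale c x \<in> V"
  shows "qspan S \<subseteq> V"
proof
  fix x assume "x \<in> qspan S"
  then obtain T c where T: "finite T" "T \<subseteq> S" "x = (\<lambda>a. \<Sum>v\<in>T. c v * v a)"
    unfolding qspan_def by blast
  from T(1,2) have "(\<lambda>a. \<Sum>v\<in>T. c v * v a) \<in> V"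
  proof (induction T)
    case (insert v T)
    then have "hadd (hscale (c v) v) (\<lambda>a. \<Sum>v\<in>T. c v * v a) \<in> V"
      using assms by blast
    with insert show ?case by (simp add: hadd_def hscale_def)
  qed (simp add: assms(2))
  with T(3) show "x \<in> V" by simp
qed

lemma qspan_sum_mset:
  assumes "\<And>p. p \<in># M \<Longrightarrow> k p \<in> qspan S"
  shows "(\<lambda>a. \<Sum>p\<in>#M. k p a) \<in> qspan S"
  using assms
proof (induction M)
  case (add p M)
  then have "hadd (k p) (\<lambda>a. \<Sum>p\<in>#M. k p a) \<in> qspan S"
    by (intro qspan_hadd) auto
  then show ?case by (simp add: hadd_def)
qed (simp add: qspan_zero)

text \<open>The sum of \<open>ImF j\<close> over \<open>j \<ge> n\<close>, spanned directly by lists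
  so that appending a primitive element raises \<open>n\<close>.\<close>

definition Fspan :: "nat \<Rightarrow> H set" where
  "Fspan n = qspan {Fmap ps | ps. length ps \<ge> n \<and> set ps \<subseteq> Prim}"

lemma Fspan_antimono: "m \<le> n \<Longrightarrow> Fspan n \<subseteq> Fspan m"
  unfolding Fspan_def[of n]
proof (rule qspan_least)
  assume "m \<le> n"
  then show "{Fmap ps |ps. n \<le> length ps \<and> set ps \<subseteq> Prim} \<subseteq> Fspan m"
    unfolding Fspan_def by (intro order.trans[OF _ qspan_superset]) auto
qed (auto simp: Fspan_def qspan_zero qspan_hadd qspan_hscale)

lemma Fspan_subset_ImF: "Fspan 2 \<subseteq> qspan ({one} \<union> (\<Union>j\<in>{2..}. ImF j))"
  unfolding Fspan_def
proof (rule qspan_least)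
  show "{Fmap ps |ps. 2 \<le> length ps \<and> set ps \<subseteq> Prim} \<subseteq> qspan ({one} \<union> (\<Union>j\<in>{2..}. ImF j))"
  proof (rule order.trans[OF _ qspan_superset])
    have "Fmap ps \<in> ImF (length ps)" if "set ps \<subseteq> Prim" for ps
      unfolding ImF_def using that by (intro subsetD[OF qspan_superset]) auto
    then show "{Fmap ps |ps. 2 \<le> length ps \<and> set ps \<subseteq> Prim} \<subseteq> {one} \<union> (\<Union>j\<in>{2..}. ImF j)"
      by fastforce
  qed
qed (auto simp: qspan_zero qspan_hadd qspan_hscale)

lemma Prim_subset_Fspan: "Prim \<subseteq> Fspan 1"
proof
  fix p assume "p \<in> Prim"
  then have "Fmap [p] \<in> Fspan 1"
    unfolding Fspan_def by (intro subsetD[OF qspan_superset]) (auto intro!: exI[of _ "[p]"])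
  then show "p \<in> Fspan 1" by (simp add: Fmap_def)
qed

lemma Fmap_snoc: "ps \<noteq> [] \<Longrightarrow> Fmap (ps @ [p]) = top (Fmap ps) p"
  by (simp add: Fmap_def)

lemma Fmap_finsupp_at_empty:
  "ps \<noteq> [] \<Longrightarrow> set ps \<subseteq> Prim \<Longrightarrow> finsupp (Fmap ps) \<and> Fmap ps {#} = 0"
proof (induction ps rule: rev_nonempty_induct)
  case (single p)
  then show ?case by (simp add: Fmap_def Prim_finsupp Prim_empty)
next
  case (snoc p ps)
  then show ?case by (simp add: Fmap_snoc Prim_finsupp)
qed

lemma top_hadd: "finsupp x \<Longrightarrow> finsupp y \<Longrightarrow> top (hadd x y) z = hadd (top x z) (top y z)"
  by (simp add: top_eq pair_hadd) (simp add: hadd_def)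

lemma top_hscale: "finsupp x \<Longrightarrow> top (hscale c x) z = hscale c (top x z)"
  by (simp add: top_eq pair_hscale) (simp add: hscale_def)

lemma top_zero: "top (\<lambda>_. 0) z = (\<lambda>_. 0)"
  by (simp add: top_eq)

lemma top_Fspan:
  assumes "x \<in> Fspan 1" "p \<in> Prim"
  shows "top x p \<in> Fspan 2"
proof -
  \<comment> \<open>Finite support belongs to the invariant because linearity of \<open>top\<close>
    is available only there.\<close>
  have "Fspan 1 \<subseteq> {x. finsupp x \<and> top x p \<in> Fspan 2}"
    unfolding Fspan_def[of 1]
  proof (rule qspan_least)
    show "{Fmap ps |ps. 1 \<le> length ps \<and> set ps \<subseteq> Prim} \<subseteq> {x. finsupp x \<and> top x p \<in> Fspan 2}"
    proof safe
      fix ps assume ps: "1 \<le> length ps" "set ps \<subseteq> Prim"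
      then show "finsupp (Fmap ps)" using Fmap_finsupp_at_empty[of ps] by (cases ps) auto
      have "Fmap (ps @ [p]) \<in> Fspan 2"
        unfolding Fspan_def using ps assms(2)
        by (intro subsetD[OF qspan_superset]) (auto intro!: exI[of _ "ps @ [p]"])
      moreover have "ps \<noteq> []" using ps by auto
      ultimately show "top (Fmap ps) p \<in> Fspan 2" by (simp add: Fmap_snoc)
    qed
  qed (auto simp: Fspan_def top_hadd top_hscale top_zero qspan_zero qspan_hadd qspan_hscale)
  with assms(1) show ?thesis by auto
qed

text \<open>The two claims are proved together: for lighter \<open>A\<close> the first puts
  \<open>A \<top> piF B\<close> into \<open>Fspan 2\<close>, and the second gives the first by
  adding the primitive \<open>piF F\<close>.\<close>

lemma basis_Fspan:
  assumes "F \<noteq> {#}"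
  shows "basis F \<in> Fspan 1" "hsub (basis F) (piF F) \<in> Fspan 2"
proof -
  have "basis F \<in> Fspan 1 \<and> hsub (basis F) (piF F) \<in> Fspan 2"
    using assms
  proof (induction F rule: forest_weight_induct)
    case (less F)
    let ?k = "\<lambda>p. if fst p = {#} \<or> snd p = {#} then (\<lambda>_. 0) else top (basis (fst p)) (piF (snd p))"
    have "?k p \<in> Fspan 2" if "p \<in># coF F" for p
    proof (cases "fst p = {#} \<or> snd p = {#}")
      case False
      then have "basis (fst p) \<in> Fspan 1"
        using that weight_coF[of "fst p" "snd p" F] weight_eq_0_iff[of "snd p"] less.IH[of "fst p"]
        by (auto simp del: weight_eq_0_iff)
      then show ?thesis using False top_Fspan[OF _ piF_Prim] by simp
    qed (auto simp: Fspan_def qspan_zero)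
    then have "(\<lambda>C. \<Sum>p\<in>#coF F. ?k p C) \<in> Fspan 2"
      unfolding Fspan_def by (rule qspan_sum_mset)
    then have 2: "hsub (basis F) (piF F) \<in> Fspan 2"
      using less.prems by (simp add: piF_eq) (simp add: hsub_def)
    have "hadd (piF F) (hsub (basis F) (piF F)) \<in> Fspan 1"
      using piF_Prim[of F] Prim_subset_Fspan 2 Fspan_antimono[of 1 2]
      unfolding Fspan_def[of 1] by (intro qspan_hadd) auto
    then have "basis F \<in> Fspan 1" by (simp add: hadd_def hsub_def)
    with 2 show ?case by blast
  qed
  then show "basis F \<in> Fspan 1" "hsub (basis F) (piF F) \<in> Fspan 2" by auto
qed

section \<open>Identification with \<open>pi1\<close>\<close>

text \<open>The finitely supported elements killed by \<open>piF\<close> form a subspace, so the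
  generators suffice: 1 by \<open>piF {#} = 0\<close>, and \<open>Fmap ps\<close> of length at least
  2 as a value \<open>x \<top> p\<close>.\<close>

lemma piF_vanishes:
  assumes "x \<in> qspan ({one} \<union> (\<Union>j\<in>{2..}. ImF j))"
  shows "finsupp x \<and> (\<forall>\<phi>. pair x (\<lambda>F. pair (piF F) \<phi>) = 0)"
proof -
  define V where "V = {x. finsupp x \<and> (\<forall>\<phi>. pair x (\<lambda>F. pair (piF F) \<phi>) = 0)}"
  have V: "(\<lambda>_. 0) \<in> V" "\<And>x y. x \<in> V \<Longrightarrow> y \<in> V \<Longrightarrow> hadd x y \<in> V"
    "\<And>c x. x \<in> V \<Longrightarrow> hscale c x \<in> V"
    by (auto simp: V_def pair_hadd pair_hscale)
  have "Fmap ps \<in> V" if ps: "length ps \<ge> 2" "set ps \<subseteq> Prim" for ps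
  proof -
    obtain qs p where qs: "ps = qs @ [p]" "qs \<noteq> []"
      using ps(1) by (cases ps rule: rev_cases) (auto simp: Suc_le_eq)
    with ps have p: "p \<in> Prim" and f: "finsupp (Fmap qs)" "Fmap qs {#} = 0"
      using Fmap_finsupp_at_empty[of qs] by auto
    \<comment> \<open>\<open>Fmap qs\<close> has no constant term, so only nonempty \<open>A\<close>
      occur.\<close>
    have "pair (Fmap qs) (\<lambda>A. attach p A (\<lambda>F. pair (piF F) \<phi>)) = pair (Fmap qs) (\<lambda>A. 0)" for \<phi>
      using f(2) by (intro pair_cong) (auto intro!: attach_piF_eq_0[OF p])
    then show ?thesis
      using p f by (simp add: V_def qs Fmap_snoc pair_top Prim_finsupp)
  qed
  then have "ImF j \<subseteq> V" if "j \<ge> 2" for j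
    unfolding ImF_def using that by (intro qspan_least V) auto
  moreover have "one \<in> V" by (simp add: V_def one_def)
  ultimately have "qspan ({one} \<union> (\<Union>j\<in>{2..}. ImF j)) \<subseteq> V"
    by (intro qspan_least V) auto
  with assms show ?thesis by (auto simp: V_def)
qed

lemma pi1_basis:
  assumes "F \<noteq> {#}"
  shows "pi1 (basis F) = piF F"
  unfolding pi1_def
proof (rule the_equality)
  show "piF F \<in> Prim \<and> hsub (basis F) (piF F) \<in> qspan ({one} \<union> (\<Union>j\<in>{2..}. ImF j))"
    using piF_Prim basis_Fspan(2)[OF assms] Fspan_subset_ImF by blast
next
  fix p
  assume p: "p \<in> Prim \<and> hsub (basis F) p \<in> qspan ({one} \<union> (\<Union>j\<in>{2..}. ImF j))"
  \<comment> \<open>\<open>\<pi>\<close> vanishes on \<open>F - p\<close> and fixes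
    \<open>p\<close>, so \<open>\<pi>(F) = p\<close>.\<close>
  then have "pair (piF F) \<phi> = pair p \<phi>" for \<phi>
    using piF_vanishes[of "hsub (basis F) p"] Prim_piF[of p]
    by (simp add: pair_hsub Prim_finsupp)
  with p show "p = piF F" by (intro pair_ext) (auto simp: Prim_finsupp)
qed

theorem theorem9p6:
  fixes F :: forest
  assumes "F \<noteq> {#}"
  shows "pi1 (basis F) = hsub (basis F) (topPi (DeltaRed (basis F)))"
proof
  fix C
  have "topPi (DeltaRed (basis F)) C
      = pair (DeltaRed (basis F)) (\<lambda>p. top (basis (fst p)) (pi1 (basis (snd p))) C)"
    by (simp add: topPi_def pair_def)
  also have "\<dots> = redsum F (\<lambda>A B. top (basis A) (pi1 (basis B)) C)"
    using assms by (simp add: pair_DeltaRed cosum_redsum)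
  \<comment> \<open>Only nonempty \<open>B\<close> contribute to \<open>redsum\<close>, and there
    \<open>pi1\<close> and \<open>piF\<close> agree.\<close>
  also have "\<dots> = redsum F (\<lambda>A B. top (basis A) (piF B) C)"
    by (rule redsum_cong) (simp add: pi1_basis)
  finally show "pi1 (basis F) C = hsub (basis F) (topPi (DeltaRed (basis F))) C"
    using assms by (simp add: pi1_basis piF_apply hsub_def)
qed

end
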